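(* For every positive integer $M$, the series on the left below converges and $$\sum_{n\ge0}(n+1)_{M-1}\bigl(1-\zeta(n+M+1)\bigr)=(-1)^{M-1}\sum_{j=0}^{M-1}\binom{M-1}{j}\, j!\,\psi^{(M-j-1)}(1)+(M-1)!\,(-1)^M+\gamma\,(-1)^{M-1}(M-1)!.$$
   Context: $\zeta$ is the Riemann zeta function and $\gamma$ is Euler's constant. The shifted factorial is $(a)_k=a(a+1)\cdots(a+k-1)$ for $k\ge1$, with $(a)_0=1$. The polygamma functions are $\psi^{(m)}(z)=\frac{d^{m+1}}{dz^{m+1}}\log\Gamma(z)$ for integers $m\ge0$; thus $\psi^{(0)}=\Gamma'/\Gamma$ is the digamma function. *)

theory Defs
  imports "HOL-Analysis.Analysis"
begin

text \<open>
  The Riemann zeta function by its Dirichlet series, $\sum_{k \ge 1} k^{-s}$. The series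
  converges only for real part of $s$ greater than 1, so the constant has its usual meaning
  on that half-plane and is unspecified elsewhere (no analytic continuation is built in).
\<close>

definition riemann_zeta :: "complex \<Rightarrow> complex" where
  "riemann_zeta s = (\<Sum>k. of_nat (Suc k) powr (- s))"

end

theory Submission
  imports Defs
begin

text \<open>
  Write \<open>N = M - 1\<close>. Expanding \<open>\<zeta>(s) - 1 = \<Sum>k\<ge>2. k powr (-s)\<close> turns the
  negated left-hand side into a double series with nonnegative terms, which may be summed in either
  order. For fixed
  \<open>k\<close>, the sum over \<open>n\<close> is a negative binomial series in \<open>x = 1 / k\<close>, because
  \<open>(n+1)\<^sub>N = N! (n+N choose N)\<close>; its value is \<open>N! x\<^sup>N\<^sup>+\<^sup>2 / (1 - x)\<^sup>N\<^sup>+\<^sup>1 = N! / (k (k - 1)\<^sup>N\<^sup>+\<^sup>1)\<close>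
  (\<open>pochhammer_power_sums\<close>).

  What remains is \<open>\<Sum>m\<ge>1. 1 / ((m + 1) m\<^sup>N\<^sup>+\<^sup>1)\<close>. Splitting off the partial
  fraction \<open>1 / m\<^sup>N\<^sup>+\<^sup>1\<close> lowers \<open>N\<close> by one at the price of \<open>\<zeta>(N + 1)\<close>, that is, of
  \<open>\<psi>\<^sup>(\<^sup>N\<^sup>)(1) / N!\<close> up to sign, and the recursion ends in a telescoping series with sum 1
  (\<open>inverse_power_times_Suc_sums\<close>). Only the polygamma functions of positive order arise in this way;
  the order-zero term of the formula, \<open>\<psi>(1) = -\<gamma>\<close>, is exactly cancelled by its term \<open>\<gamma>\<close>.
\<close>

text \<open>
  Both sides, multiplied by \<open>n!\<close>, are \<open>(n + N)!\<close>. On the right the index \<open>n\<close> has moved to the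
  length of the product, which is the shape of a binomial coefficient with fixed upper
  argument \<open>-(N + 1)\<close>.
\<close>

lemma pochhammer_Suc_nat_conv:
  "pochhammer (of_nat (Suc n) :: 'a :: field_char_0) N
     = fact N * (pochhammer (of_nat (Suc N)) n / fact n)"
proof -
  have "fact n * pochhammer (of_nat (Suc n) :: 'a) N = pochhammer 1 (n + N)"
    by (simp add: pochhammer_product' pochhammer_fact)
  also have "\<dots> = fact N * pochhammer (of_nat (Suc N)) n"
    by (subst add.commute, simp add: pochhammer_product' pochhammer_fact)
  finally show ?thesis
    by (simp add: field_simps)
qed

text \<open>
  Newton's binomial series for the exponent \<open>-(N + 1)\<close> at \<open>-x\<close>.
\<close>

lemma pochhammer_power_sums:
  fixes x :: real
  assumes "\<bar>x\<bar> < 1"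
  shows "(\<lambda>n. pochhammer (of_nat (Suc n)) N * x ^ n) sums (fact N / (1 - x) ^ Suc N)"
proof -
  have "(\<lambda>n. ((- of_nat (Suc N)) gchoose n) * (- x) ^ n) sums (1 + (- x)) powr (- of_nat (Suc N))"
    using assms by (intro gen_binomial_real) auto
  moreover have "((- of_nat (Suc N) :: real) gchoose n) * (- x) ^ n
      = pochhammer (of_nat (Suc N)) n / fact n * x ^ n" for n
  proof -
    have "(-1) ^ n * (- x) ^ n = x ^ n"
      by (simp flip: power_mult_distrib)
    thus ?thesis
      by (simp add: gbinomial_pochhammer mult_ac del: of_nat_Suc)
  qed
  moreover have "(1 + (- x)) powr (- of_nat (Suc N)) = 1 / (1 - x) ^ Suc N"
    using assms by (subst powr_minus, subst powr_realpow) (auto simp: divide_inverse)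
  ultimately have "(\<lambda>n. pochhammer (of_nat (Suc N)) n / fact n * x ^ n) sums (1 / (1 - x) ^ Suc N)"
    by simp
  from sums_mult[OF this, of "fact N"] show ?thesis
    by (simp add: pochhammer_Suc_nat_conv[where N = N] mult.assoc del: of_nat_Suc)
qed

text \<open>
  Induction on \<open>N\<close> by means of \<open>1 / ((y + 1) y\<^sup>N\<^sup>+\<^sup>2) = 1 / y\<^sup>N\<^sup>+\<^sup>2 - 1 / ((y + 1) y\<^sup>N\<^sup>+\<^sup>1)\<close> at \<open>y = m + 1\<close>. The
  subtraction accounts for the alternating sign. Letting the polygamma sum start at order zero gives it
  the shape of the final formula; its first term \<open>-\<gamma>\<close> is offset by the explicit
  \<open>-\<gamma>\<close>.
\<close>

lemma inverse_power_times_Suc_sums: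
  "(\<lambda>m. 1 / ((real m + 2) * (real m + 1) ^ Suc N))
     sums ((-1) ^ N * (1 - euler_mascheroni - (\<Sum>i\<le>N. Polygamma i 1 / fact i)))"
proof (induction N)
  case 0
  have "(\<lambda>m. inverse (real (Suc m))) \<longlonglongrightarrow> 0"
    by (rule LIMSEQ_inverse_real_of_nat)
  from telescope_sums'[OF this]
  have "(\<lambda>m. inverse (real (Suc m)) - inverse (real (Suc (Suc m)))) sums 1"
    by simp
  moreover have "inverse (real (Suc m)) - inverse (real (Suc (Suc m)))
      = 1 / ((real m + 2) * (real m + 1) ^ Suc 0)" for m
    by (simp add: field_simps)
  ultimately show ?case
    by (simp add: Digamma_1)
next
  case (Suc N)
  have "(\<lambda>m. inverse ((1 + real m) ^ Suc (Suc N)))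
      sums ((-1) ^ Suc (Suc N) * Polygamma (Suc N) 1 / fact (Suc N))"
    by (intro Polygamma_LIMSEQ) auto
  from sums_diff[OF this Suc.IH]
  have *: "(\<lambda>m. inverse ((1 + real m) ^ Suc (Suc N)) - 1 / ((real m + 2) * (real m + 1) ^ Suc N))
      sums ((-1) ^ Suc N * (1 - euler_mascheroni - (\<Sum>i\<le>Suc N. Polygamma i 1 / fact i)))"
    by (simp add: algebra_simps del: fact_Suc)
  have "inverse ((1 + real m) ^ Suc (Suc N)) - 1 / ((real m + 2) * (real m + 1) ^ Suc N)
      = 1 / ((real m + 2) * (real m + 1) ^ Suc (Suc N))" for m
  proof -
    have "inverse (y ^ Suc (Suc N)) - 1 / ((y + 1) * y ^ Suc N) = 1 / ((y + 1) * y ^ Suc (Suc N))"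
      if "y > 0" for y :: real
      using that by (simp add: divide_simps)
    from this[of "real m + 1"] show ?thesis by (simp add: add_ac)
  qed
  with * show ?case by simp
qed

text \<open>
  Taking the real part lets the double series be treated over the reals, where nonnegativity makes
  sense; the second claim allows the return to complex values.
\<close>

lemma zeta_minus_one_sums:
  assumes "s \<ge> 2"
  shows "(\<lambda>m. (1 / (real m + 2)) ^ s) sums (Re (riemann_zeta (of_nat s)) - 1)"
    and "riemann_zeta (of_nat s) = of_real (Re (riemann_zeta (of_nat s)))"
proof -
  define g where "g = (\<lambda>k. (1 / real (Suc k)) ^ s)"
  have "summable (\<lambda>k. inverse (real k ^ s))"
    using inverse_power_summable[OF assms, where ?'a = real] .
  hence "summable (\<lambda>k. inverse (real (Suc k) ^ s))"
    by (subst summable_Suc_iff)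
  hence g: "summable g"
    by (simp add: g_def power_one_over power_inverse divide_inverse)
  have "of_nat (Suc k) powr (- of_nat s) = (complex_of_real (g k))" for k
    using powr_nat'[of "of_nat (Suc k) :: complex" s] assms
    by (simp add: powr_minus g_def power_inverse divide_inverse del: of_nat_Suc)
  hence zeta: "riemann_zeta (of_nat s) = of_real (suminf g)"
    using suminf_of_real[OF g, where ?'a = complex] by (simp add: riemann_zeta_def)
  thus "riemann_zeta (of_nat s) = of_real (Re (riemann_zeta (of_nat s)))" 
    by simp
  have "(\<lambda>m. g (Suc m)) sums (suminf g - g 0)"
    using g by (subst sums_Suc_iff) (simp add: summable_sums)
  with zeta show "(\<lambda>m. (1 / (real m + 2)) ^ s) sums (Re (riemann_zeta (of_nat s)) - 1)"
    by (simp add: g_def add_ac)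
qed

text \<open>
  Tonelli's theorem for double series. Convergence of the series of column sums is part of the
  conclusion: for nonnegative terms, convergence of the series of row sums already makes the whole
  grid unconditionally summable.
\<close>

lemma sums_swap_nonneg:
  fixes f :: "nat \<Rightarrow> nat \<Rightarrow> real"
  assumes nonneg: "\<And>m n. f m n \<ge> 0"
    and rows: "\<And>m. f m sums r m" and total: "r sums S"
    and cols: "\<And>n. (\<lambda>m. f m n) sums c n"
  shows "c sums S"
proof -
  have r_nonneg: "r m \<ge> 0" for m
    using sums_le[OF _ sums_zero rows[of m]] nonneg by simp
  have rows': "(f m has_sum r m) UNIV" for m
    using rows nonneg by (intro sums_nonneg_imp_has_sum) auto
  have total': "(r has_sum S) UNIV"
    using total r_nonneg by (intro sums_nonneg_imp_has_sum) auto
  have cols': "((\<lambda>m. f m n) has_sum c n) UNIV" for n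
    using cols nonneg by (intro sums_nonneg_imp_has_sum) auto
  have "r summable_on UNIV"
    using total' by (rule has_sum_imp_summable)
  hence "(\<lambda>(m, n). f m n) summable_on UNIV \<times> UNIV"
    using rows' nonneg by (intro summable_on_SigmaI[where g = r]) simp_all
  hence "((\<lambda>(m, n). f m n) has_sum S) (UNIV \<times> UNIV)"
    using total' rows' by (intro has_sum_SigmaI[where g = r]) simp_all
  hence "((\<lambda>(n, m). f m n) has_sum S) (UNIV \<times> UNIV)"
    using has_sum_swap[where f = "\<lambda>(m, n). f m n" and A = UNIV and B = UNIV] by simp
  hence "(c has_sum S) UNIV"
    by (rule has_sum_SigmaD) (simp add: cols')
  thus ?thesis by (rule has_sum_imp_sums)
qed

text \<open>
  The interchange of summation: rows are indexed by \<open>m = k - 2\<close> and are negative binomial series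
  in \<open>1 / k\<close>, columns are indexed by \<open>n\<close> and give the values of \<open>\<zeta> - 1\<close>.
\<close>

lemma pochhammer_zeta_minus_one_sums:
  "(\<lambda>n. pochhammer (real (n + 1)) N * (Re (riemann_zeta (of_nat (n + N + 2))) - 1))
     sums (fact N * ((-1) ^ N * (1 - euler_mascheroni - (\<Sum>i\<le>N. Polygamma i 1 / fact i))))"
proof (rule sums_swap_nonneg)
  let ?x = "\<lambda>m. 1 / (real m + 2)"
  show "0 \<le> pochhammer (real (n + 1)) N * ?x m ^ (n + N + 2)" for m n
    by (simp add: pochhammer_nonneg)
  show "(\<lambda>n. pochhammer (real (n + 1)) N * ?x m ^ (n + N + 2))
          sums (fact N * (1 / ((real m + 2) * (real m + 1) ^ Suc N)))" for m
  proof -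
    have "(\<lambda>n. ?x m ^ (N + 2) * (pochhammer (real (Suc n)) N * ?x m ^ n))
        sums (?x m ^ (N + 2) * (fact N / (1 - ?x m) ^ Suc N))"
      by (intro sums_mult pochhammer_power_sums) auto
    moreover have "?x m ^ (N + 2) * (fact N / (1 - ?x m) ^ Suc N)
        = fact N * (1 / ((real m + 2) * (real m + 1) ^ Suc N))"
    proof -
      have "1 - ?x m = (real m + 1) / (real m + 2)" by (simp add: field_simps)
      thus ?thesis by (simp add: power_divide)
    qed
    ultimately show ?thesis by (simp add: power_add mult_ac)
  qed
  show "(\<lambda>m. fact N * (1 / ((real m + 2) * (real m + 1) ^ Suc N)))
     sums (fact N * ((-1) ^ N * (1 - euler_mascheroni - (\<Sum>i\<le>N. Polygamma i 1 / fact i))))"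
    by (intro sums_mult inverse_power_times_Suc_sums)
  show "(\<lambda>m. pochhammer (real (n + 1)) N * ?x m ^ (n + N + 2))
     sums (pochhammer (real (n + 1)) N * (Re (riemann_zeta (of_nat (n + N + 2))) - 1))" for n
    by (intro sums_mult zeta_minus_one_sums) auto
qed

text \<open>
  The factorials in \<open>N! / (j! (N - j)!)\<close> cancel against \<open>j!\<close>, after which the sum is read
  backwards.
\<close>

lemma sum_choose_fact_conv:
  fixes f :: "nat \<Rightarrow> 'a :: field_char_0"
  shows "(\<Sum>j = 0..N. of_nat (N choose j) * fact j * f (N - j)) = fact N * (\<Sum>i\<le>N. f i / fact i)"
proof -
  have "(\<Sum>j = 0..N. of_nat (N choose j) * fact j * f (N - j))
      = (\<Sum>j\<le>N. fact N * (f (N - j) / fact (N - j)))"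
    by (intro sum.cong) (auto simp: binomial_fact)
  also have "\<dots> = (\<Sum>i\<le>N. fact N * (f i / fact i))"
    by (rule sum.reindex_bij_witness[of _ "\<lambda>i. N - i" "\<lambda>i. N - i"]) auto
  finally show ?thesis by (simp add: sum_distrib_left)
qed

theorem theorem2p2:
  fixes M :: nat
  assumes "M \<ge> 1"
  shows "(\<lambda>n. pochhammer (of_nat (n + 1)) (M - 1) * (1 - riemann_zeta (of_nat (n + M + 1))))
           sums ((-1) ^ (M - 1) *
                   (\<Sum>j = 0..M - 1. of_nat ((M - 1) choose j) * fact j * Polygamma (M - j - 1) (1 :: complex))
                 + fact (M - 1) * (-1) ^ M
                 + euler_mascheroni * (-1) ^ (M - 1) * fact (M - 1))"
proof -
  obtain N where M: "M = Suc N"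
    using assms by (cases M) auto
  define P where "P = (\<Sum>i\<le>N. Polygamma i (1 :: real) / fact i)"
  define S where "S = fact N * ((-1) ^ N * (1 - euler_mascheroni - P))"
  have "(\<lambda>n. - complex_of_real (pochhammer (real (n + 1)) N *
          (Re (riemann_zeta (of_nat (n + N + 2))) - 1))) sums (- complex_of_real S)"
    unfolding S_def P_def by (intro sums_minus sums_of_real pochhammer_zeta_minus_one_sums)
  moreover have "- complex_of_real (pochhammer (real (n + 1)) N *
          (Re (riemann_zeta (of_nat (n + N + 2))) - 1))
      = pochhammer (of_nat (n + 1)) (M - 1) * (1 - riemann_zeta (of_nat (n + M + 1)))" for n
  proof -
    have "complex_of_real (Re (riemann_zeta (of_nat (n + N + 2)))) = riemann_zeta (of_nat (n + N + 2))"
      by (rule zeta_minus_one_sums(2)[symmetric]) simp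
    moreover have "n + M + 1 = n + N + 2" using M by simp
    moreover have "complex_of_real (pochhammer (real (n + 1)) N) = pochhammer (of_nat (n + 1)) N"
      by (simp flip: pochhammer_of_real)
    ultimately show ?thesis
      by (simp only: M of_real_mult of_real_diff of_real_1 diff_Suc_1)
        (simp only: mult_1_left mult_1_right minus_mult_right minus_diff_eq)
  qed
  moreover have "- complex_of_real S = (-1) ^ (M - 1) *
        (\<Sum>j = 0..M - 1. of_nat ((M - 1) choose j) * fact j * Polygamma (M - j - 1) (1 :: complex))
      + fact (M - 1) * (-1) ^ M + euler_mascheroni * (-1) ^ (M - 1) * fact (M - 1)"
  proof -
    have "of_real (Polygamma i 1) = Polygamma i (1 :: complex)" for i
      using Polygamma_of_real[of 1 i, where ?'a = complex] by simp
    hence "complex_of_real P = (\<Sum>i\<le>N. Polygamma i 1 / fact i)"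
      by (simp add: P_def)
    hence "(\<Sum>j = 0..M - 1. of_nat ((M - 1) choose j) * fact j * Polygamma (M - j - 1) (1 :: complex))
        = fact N * of_real P"
      using sum_choose_fact_conv[of N "\<lambda>i. Polygamma i (1 :: complex)"] by (simp add: M)
    thus ?thesis
      by (simp only:) (simp add: S_def M algebra_simps)
  qed
  ultimately show ?thesis
    by (simp only:)
qed

end
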